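(* Let $A$ be a C*-algebra represented faithfully and non-degenerately on a Hilbert space $H$ (so $A\subseteq\mathcal B(H)$). There are order isomorphisms between the set $[A]^\perp$ of annihilators of $A$ (ordered by inclusion) and the set $\overline{\mathcal P(A'')}^\circ$ of topologically regular open projections (with the usual order of projections) given by $$B\mapsto p_B\qquad\text{and}\qquad p\mapsto pAp\cap A .$$
   Context: For $a,b\in A$ write $a\perp b$ if $ab=0=ab^*$, and for $S\subseteq A$ put $S^\perp=\{b\in A:s\perp b\text{ for all }s\in S\}$. An annihilator of $A$ is a set of the form $S^\perp$, $S\subseteq A$; $[A]^\perp$ is the set of annihilators. For a C*-subalgebra $B\subseteq A$ let $B^1_+$ be the set of positive elements of $B$ of norm at most $1$, and $p_B=\sup B^1_+$, a projection in $A''$ (the strong limit of the increasing net $\{b\in B_+:\|b\|<1\}$). A projection $p\in\mathcal B(H)$ is open if $p=\sup_\alpha a_\alpha$ for some increasing net $(a_\alpha)\subseteq A^1_+$, and closed if $p^\perp=1-p$ is open; open and closed projections lie in $A''$. The interior of a projection $p\in\mathcal B(H)$ is $p^\circ=\sup(pAp\cap A)^1_+$ (the largest open projection below $p$), and its closure is $\overline p=1-(1-p)^\circ$. A projection $p$ is topologically regular (open) if $p=(\overline p)^\circ$. The order on projections is $p\le q\Leftrightarrow pq=p$. *)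

theory Defs
  imports "HOL-Analysis.Analysis"
begin

text \<open>
  A complex Hilbert space is a complete real inner product space together with a complex scalar
  multiplication extending the real one and a sesquilinear inner product, linear in its first
  argument, whose real part is the given real inner product. The norm is therefore
  \<open>sqrt (Re (cinner x x))\<close>, and positive definiteness is inherited from \<^class>\<open>real_inner\<close>.
\<close>

class complex_hilbert = real_inner + complete_space +
  fixes scaleC :: "complex \<Rightarrow> 'a \<Rightarrow> 'a" (infixr "*\<^sub>C" 75)
    and cinner :: "'a \<Rightarrow> 'a \<Rightarrow> complex"
  assumes scaleC_add_right: "c *\<^sub>C (x + y) = c *\<^sub>C x + c *\<^sub>C y"
    and scaleC_add_left: "(c + d) *\<^sub>C x = c *\<^sub>C x + d *\<^sub>C x"
    and scaleC_scaleC: "c *\<^sub>C (d *\<^sub>C x) = (c * d) *\<^sub>C x"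
    and scaleC_of_real: "complex_of_real r *\<^sub>C x = r *\<^sub>R x"
    and cinner_add_left: "cinner (x + y) z = cinner x z + cinner y z"
    and cinner_scaleC_left: "cinner (c *\<^sub>C x) y = c * cinner x y"
    and cinner_commute: "cinner x y = cnj (cinner y x)"
    and Re_cinner: "Re (cinner x y) = inner x y"
begin

lemma cinner_scaleC_right: "cinner x (c *\<^sub>C y) = cnj c * cinner x y"
  by (metis cinner_commute cinner_scaleC_left complex_cnj_mult complex_cnj_cnj)

lemma norm_scaleC: "norm (c *\<^sub>C x) = cmod c * norm x"
proof -
  have "cinner (c *\<^sub>C x) (c *\<^sub>C x) = (c * cnj c) * cinner x x"
    by (simp add: cinner_scaleC_left cinner_scaleC_right)
  also have "\<dots> = complex_of_real ((cmod c)\<^sup>2) * cinner x x"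
    by (simp only: complex_norm_square)
  finally have "Re (cinner (c *\<^sub>C x) (c *\<^sub>C x)) = (cmod c)\<^sup>2 * Re (cinner x x)"
    by simp
  then show ?thesis
    by (simp add: Re_cinner norm_eq_sqrt_inner real_sqrt_mult)
qed

end

text \<open>
  \<open>\<B>(H)\<close> is the set of complex-linear elements of the library type of bounded real-linear operators;
  the norm and the metric topology of that type are the operator norm and its topology.
\<close>

definition bounded_ops :: "('h::complex_hilbert \<Rightarrow>\<^sub>L 'h) set" where
  "bounded_ops = {T. \<forall>c x. blinfun_apply T (c *\<^sub>C x) = c *\<^sub>C blinfun_apply T x}"

lift_definition scaleC_op :: "complex \<Rightarrow> ('h::complex_hilbert \<Rightarrow>\<^sub>L 'h) \<Rightarrow> ('h \<Rightarrow>\<^sub>L 'h)"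
  is "\<lambda>c f x. c *\<^sub>C f x"
proof -
  fix c :: complex and f :: "'h \<Rightarrow> 'h"
  assume f: "bounded_linear f"
  have "bounded_linear (\<lambda>x::'h. c *\<^sub>C x)"
  proof (rule bounded_linear_intro[where K = "cmod c"])
    fix r :: real and x :: 'h
    show "c *\<^sub>C (r *\<^sub>R x) = r *\<^sub>R (c *\<^sub>C x)"
      by (metis scaleC_of_real scaleC_scaleC mult.commute)
  qed (simp_all add: scaleC_add_right norm_scaleC)
  from bounded_linear_compose[OF this f] show "bounded_linear (\<lambda>x. c *\<^sub>C f x)" .
qed

text \<open>By the Riesz representation theorem the adjoint exists for every operator in \<open>\<B>(H)\<close>.\<close>

definition adj :: "('h::complex_hilbert \<Rightarrow>\<^sub>L 'h) \<Rightarrow> ('h \<Rightarrow>\<^sub>L 'h)" where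
  "adj T = (THE S. \<forall>x y. cinner (blinfun_apply S x) y = cinner x (blinfun_apply T y))"

definition self_adjoint :: "('h::complex_hilbert \<Rightarrow>\<^sub>L 'h) \<Rightarrow> bool" where
  "self_adjoint T \<longleftrightarrow> T \<in> bounded_ops \<and> adj T = T"

definition positive_op :: "('h::complex_hilbert \<Rightarrow>\<^sub>L 'h) \<Rightarrow> bool" where
  "positive_op T \<longleftrightarrow> self_adjoint T \<and> (\<forall>x. cinner (blinfun_apply T x) x \<in> \<real>\<^sub>\<ge>\<^sub>0)"

definition op_le :: "('h::complex_hilbert \<Rightarrow>\<^sub>L 'h) \<Rightarrow> ('h \<Rightarrow>\<^sub>L 'h) \<Rightarrow> bool" (infix "\<preceq>" 50) where
  "S \<preceq> T \<longleftrightarrow> positive_op (T - S)"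

text \<open>
  Suprema are least upper bounds among all self-adjoint operators in \<open>\<B>(H)\<close>. For a bounded
  increasing net this is its strong limit.
\<close>

definition is_op_sup :: "('h::complex_hilbert \<Rightarrow>\<^sub>L 'h) set \<Rightarrow> ('h \<Rightarrow>\<^sub>L 'h) \<Rightarrow> bool" where
  "is_op_sup D T \<longleftrightarrow> self_adjoint T \<and> (\<forall>S\<in>D. S \<preceq> T) \<and>
     (\<forall>U. self_adjoint U \<and> (\<forall>S\<in>D. S \<preceq> U) \<longrightarrow> T \<preceq> U)"

definition op_sup :: "('h::complex_hilbert \<Rightarrow>\<^sub>L 'h) set \<Rightarrow> ('h \<Rightarrow>\<^sub>L 'h)" where
  "op_sup D = (THE T. is_op_sup D T)"

definition cstar_algebra :: "('h::complex_hilbert \<Rightarrow>\<^sub>L 'h) set \<Rightarrow> bool" where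
  "cstar_algebra A \<longleftrightarrow> A \<subseteq> bounded_ops \<and> 0 \<in> A \<and>
     (\<forall>a\<in>A. \<forall>b\<in>A. a + b \<in> A) \<and> (\<forall>c. \<forall>a\<in>A. scaleC_op c a \<in> A) \<and>
     (\<forall>a\<in>A. \<forall>b\<in>A. a o\<^sub>L b \<in> A) \<and> (\<forall>a\<in>A. adj a \<in> A) \<and> closed A"

text \<open>
  Since a C*-algebra is closed under complex scalars, the real span below is already a complex
  subspace.
\<close>

definition nondegenerate :: "('h::complex_hilbert \<Rightarrow>\<^sub>L 'h) set \<Rightarrow> bool" where
  "nondegenerate A \<longleftrightarrow> closure (span {blinfun_apply a x |a x. a \<in> A}) = UNIV"

definition commutant :: "('h::complex_hilbert \<Rightarrow>\<^sub>L 'h) set \<Rightarrow> ('h \<Rightarrow>\<^sub>L 'h) set" where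
  "commutant A = {T \<in> bounded_ops. \<forall>a\<in>A. T o\<^sub>L a = a o\<^sub>L T}"

definition perp :: "('h::complex_hilbert \<Rightarrow>\<^sub>L 'h) \<Rightarrow> ('h \<Rightarrow>\<^sub>L 'h) \<Rightarrow> bool" where
  "perp a b \<longleftrightarrow> a o\<^sub>L b = 0 \<and> a o\<^sub>L adj b = 0"

definition annihilator :: "('h::complex_hilbert \<Rightarrow>\<^sub>L 'h) set \<Rightarrow> ('h \<Rightarrow>\<^sub>L 'h) set \<Rightarrow> ('h \<Rightarrow>\<^sub>L 'h) set" where
  "annihilator A S = {b \<in> A. \<forall>s\<in>S. perp s b}"

definition annihilators :: "('h::complex_hilbert \<Rightarrow>\<^sub>L 'h) set \<Rightarrow> ('h \<Rightarrow>\<^sub>L 'h) set set" where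
  "annihilators A = {annihilator A S |S. S \<subseteq> A}"

definition pos_unit_ball :: "('h::complex_hilbert \<Rightarrow>\<^sub>L 'h) set \<Rightarrow> ('h \<Rightarrow>\<^sub>L 'h) set" where
  "pos_unit_ball B = {b \<in> B. positive_op b \<and> norm b \<le> 1}"

definition support_proj :: "('h::complex_hilbert \<Rightarrow>\<^sub>L 'h) set \<Rightarrow> ('h \<Rightarrow>\<^sub>L 'h)" where
  "support_proj B = op_sup (pos_unit_ball B)"

definition projection :: "('h::complex_hilbert \<Rightarrow>\<^sub>L 'h) \<Rightarrow> bool" where
  "projection p \<longleftrightarrow> self_adjoint p \<and> p o\<^sub>L p = p"

definition proj_le :: "('h::complex_hilbert \<Rightarrow>\<^sub>L 'h) \<Rightarrow> ('h \<Rightarrow>\<^sub>L 'h) \<Rightarrow> bool" where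
  "proj_le p q \<longleftrightarrow> p o\<^sub>L q = p"

text \<open>
  An increasing net is represented by its range, a nonempty upward directed set \<open>D\<close>; conversely such
  a set is an increasing net indexed by itself.
\<close>

definition open_proj :: "('h::complex_hilbert \<Rightarrow>\<^sub>L 'h) set \<Rightarrow> ('h \<Rightarrow>\<^sub>L 'h) \<Rightarrow> bool" where
  "open_proj A p \<longleftrightarrow> projection p \<and>
     (\<exists>D. D \<noteq> {} \<and> D \<subseteq> pos_unit_ball A \<and>
       (\<forall>a\<in>D. \<forall>b\<in>D. \<exists>c\<in>D. a \<preceq> c \<and> b \<preceq> c) \<and> is_op_sup D p)"

text \<open>The set \<open>pAp \<inter> A\<close>.\<close>

definition corner :: "('h::complex_hilbert \<Rightarrow>\<^sub>L 'h) set \<Rightarrow> ('h \<Rightarrow>\<^sub>L 'h) \<Rightarrow> ('h \<Rightarrow>\<^sub>L 'h) set" where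
  "corner A p = {p o\<^sub>L a o\<^sub>L p |a. a \<in> A} \<inter> A"

definition proj_interior :: "('h::complex_hilbert \<Rightarrow>\<^sub>L 'h) set \<Rightarrow> ('h \<Rightarrow>\<^sub>L 'h) \<Rightarrow> ('h \<Rightarrow>\<^sub>L 'h)" where
  "proj_interior A p = op_sup (pos_unit_ball (corner A p))"

definition proj_closure :: "('h::complex_hilbert \<Rightarrow>\<^sub>L 'h) set \<Rightarrow> ('h \<Rightarrow>\<^sub>L 'h) \<Rightarrow> ('h \<Rightarrow>\<^sub>L 'h)" where
  "proj_closure A p = id_blinfun - proj_interior A (id_blinfun - p)"

definition regular_open_projs :: "('h::complex_hilbert \<Rightarrow>\<^sub>L 'h) set \<Rightarrow> ('h \<Rightarrow>\<^sub>L 'h) set" where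
  "regular_open_projs A = {p \<in> commutant (commutant A).
     projection p \<and> open_proj A p \<and> proj_interior A (proj_closure A p) = p}"

definition order_iso_on ::
  "'a set \<Rightarrow> ('a \<Rightarrow> 'a \<Rightarrow> bool) \<Rightarrow> 'b set \<Rightarrow> ('b \<Rightarrow> 'b \<Rightarrow> bool) \<Rightarrow> ('a \<Rightarrow> 'b) \<Rightarrow> bool" where
  "order_iso_on X leX Y leY f \<longleftrightarrow>
     bij_betw f X Y \<and> (\<forall>x\<in>X. \<forall>y\<in>X. leX x y \<longleftrightarrow> leY (f x) (f y))"

end

theory Submission
  imports Defs
begin

text \<open>
  Everything is read off from kernels. For a C*-subalgebra \<open>B\<close> the projection \<open>p\<^sub>B\<close> is the one whose
  kernel is the common kernel of the operators in \<open>B\<close>; since \<open>B\<close> is closed under adjoints, the range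
  of \<open>p\<^sub>B\<close> is then the closed span of \<open>BH\<close>. Granting this, \<open>p\<^sub>B a = 0\<close> holds exactly if
  \<open>ba = 0\<close> for all \<open>b \<in> B\<close>, and hence the corner of \<open>1 - p\<^sub>B\<close> is the annihilator \<open>B\<^sup>\<bottom>\<close>
  (lemmas \<open>corner_complement\<close> and \<open>annihilator_support_proj\<close>). The three parts of the theorem follow.

  \<^item> If \<open>B = S\<^sup>\<bottom>\<close>, the corner of \<open>p\<^sub>B\<close> is \<open>B\<close> again: \<open>s \<in> S\<close> kills \<open>BH\<close>, hence \<open>sp\<^sub>B = 0\<close>, so \<open>s\<close>
    kills everything in the corner.

  \<^item> The interior of the closure of \<open>p\<close> is the support projection of \<open>{p}\<^sup>\<bottom>\<^sup>\<bottom>\<close>. For \<open>p = p\<^sub>B\<close> this is the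
    support projection of \<open>B\<^sup>\<bottom>\<^sup>\<bottom> = B\<close>, which is \<open>p\<close> again; conversely a \<open>p\<close> that equals
    the interior of its closure is visibly the support projection of an annihilator.

  \<^item> A larger annihilator has a smaller common kernel, hence a larger projection; and if \<open>p \<le> q\<close>,
    everything fixed by \<open>p\<close> is fixed by \<open>q\<close>, so the corners are nested.

  The analytic content is the identification of \<open>p\<^sub>B\<close>, which is defined as a least upper bound in the
  operator order. The elements \<open>c(1 + c)\<^sup>-\<^sup>1\<close> with \<open>c \<in> B\<close> positive form an upward directed set inside
  the positive unit ball of \<open>B\<close>, and on the range of \<open>p\<^sub>B\<close> their quadratic forms approximate that of the
  identity. Functional calculus is avoided: \<open>x = c(1 + c)\<^sup>-\<^sup>1\<close> is characterised by \<open>x + cx = c\<close>, an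
  equation that the Banach fixed point theorem solves inside \<open>B\<close>, and all the order properties are
  computed directly with quadratic forms. Only real inner products enter these computations, because
  the complex inner product of complex-linear operators is controlled by its real part.
\<close>

section \<open>Orthogonal projection and adjoints in Hilbert space\<close>

text \<open>
  This makes the operators on a Hilbert space a Banach space, as needed for the fixed point
  theorem in closed sets of operators.
\<close>

subclass (in complex_hilbert) banach ..

text \<open>
  By the parallelogram law, two points of \<open>S\<close> whose norms are nearly minimal are close together,
  because their midpoint in \<open>S\<close> has at least the minimal norm. So the sets of near-minimisers
  shrink to a point.
\<close>

lemma min_norm_point_exists:
  fixes S :: "'a::{real_inner,complete_space} set"
  assumes "closed S" "convex S" "S \<noteq> {}"
  shows "\<exists>z\<in>S. \<forall>y\<in>S. norm z \<le> norm y"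
proof -
  define d where "d = Inf (norm ` S)"
  have d0: "0 \<le> d"
    unfolding d_def using assms(3) by (intro cInf_greatest) auto
  have dle: "d \<le> norm y" if "y \<in> S" for y
    unfolding d_def using that by (intro cInf_lower bdd_belowI2[where m = 0]) auto
  define C where "C n = {y \<in> S. (norm y)\<^sup>2 \<le> d\<^sup>2 + inverse (real (Suc n))}" for n
  have closedC: "closed (C n)" for n
  proof -
    have "C n = S \<inter> {y. (norm y)\<^sup>2 \<le> d\<^sup>2 + inverse (real (Suc n))}"
      by (auto simp: C_def)
    also have "closed \<dots>"
      by (intro closed_Int assms(1) closed_Collect_le continuous_intros)
    finally show ?thesis .
  qed
  have neC: "C n \<noteq> {}" for n
  proof -
    have "d < sqrt (d\<^sup>2 + inverse (real (Suc n)))"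
      using d0 by (intro real_less_rsqrt) auto
    then obtain y where "y \<in> S" "norm y < sqrt (d\<^sup>2 + inverse (real (Suc n)))"
      using assms(3) cInf_lessD[of "norm ` S"] unfolding d_def by auto
    then have "(norm y)\<^sup>2 \<le> (sqrt (d\<^sup>2 + inverse (real (Suc n))))\<^sup>2"
      by (intro power_mono) auto
    with \<open>y \<in> S\<close> have "y \<in> C n"
      by (simp add: C_def)
    then show ?thesis by blast
  qed
  have decC: "C n \<subseteq> C m" if "m \<le> n" for m n
  proof -
    have "inverse (real (Suc n)) \<le> inverse (real (Suc m))"
      using that by (intro le_imp_inverse_le) auto
    then show ?thesis unfolding C_def by (blast intro: order_trans add_left_mono)
  qed
  have diam: "(dist x y)\<^sup>2 \<le> 4 * inverse (real (Suc n))" if "x \<in> C n" "y \<in> C n" for x y n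
  proof -
    have "x \<in> S" "y \<in> S" using that by (auto simp: C_def)
    then have "(1/2) *\<^sub>R x + (1/2) *\<^sub>R y \<in> S"
      using assms(2) by (simp add: convexD)
    from dle[OF this] have "2 * d \<le> norm (x + y)"
      by (simp add: scaleR_add_right[symmetric])
    then have "(2 * d)\<^sup>2 \<le> (norm (x + y))\<^sup>2"
      using d0 by (intro power_mono) auto
    moreover have "(norm (x - y))\<^sup>2 = 2 * (norm x)\<^sup>2 + 2 * (norm y)\<^sup>2 - (norm (x + y))\<^sup>2"
      by (simp add: power2_norm_eq_inner inner_add inner_diff inner_commute)
    ultimately show ?thesis
      using that by (simp add: C_def dist_norm power_mult_distrib)
  qed
  have small: "\<exists>n. \<forall>x\<in>C n. \<forall>y\<in>C n. dist x y < e" if "e > 0" for e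
  proof -
    have "0 < e\<^sup>2 / 4" using that by simp
    then obtain n where n: "inverse (real (Suc n)) < e\<^sup>2 / 4"
      using reals_Archimedean by blast
    have "dist x y < e" if "x \<in> C n" "y \<in> C n" for x y
      using diam[OF that] n \<open>e > 0\<close> by (intro power2_less_imp_less[of _ e]) auto
    then show ?thesis by blast
  qed
  obtain z where z: "\<Inter>(range C) = {z}"
    using decreasing_closed_nest_sing[of C, OF closedC neC decC small] by blast
  have zC: "z \<in> C n" for n using z by blast
  have "(norm z)\<^sup>2 \<le> d\<^sup>2"
  proof (rule field_le_epsilon)
    fix e :: real assume "0 < e"
    then obtain n where "inverse (real (Suc n)) < e"
      using reals_Archimedean by blast
    then show "(norm z)\<^sup>2 \<le> d\<^sup>2 + e" using zC[of n] by (simp add: C_def)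
  qed
  then have "norm z \<le> d" using d0 by (rule power2_le_imp_le)
  then have "norm z \<le> norm y" if "y \<in> S" for y
    using dle[OF that] by linarith
  moreover have "z \<in> S" using zC[of 0] by (simp add: C_def)
  ultimately show ?thesis by blast
qed

text \<open>
  If \<open>x - q\<close> has minimal norm among all \<open>x - y\<close> with \<open>y \<in> N\<close>, moving \<open>q\<close> in any direction of \<open>N\<close>
  cannot shorten it, which forces orthogonality.
\<close>

lemma orthogonal_decomposition:
  fixes N :: "'a::{real_inner,complete_space} set"
  assumes "closed N" "subspace N"
  shows "\<exists>q\<in>N. \<forall>y\<in>N. inner (x - q) y = 0"
proof -
  let ?S = "(\<lambda>y. x - y) ` N"
  have "?S = (+) x ` uminus ` N"
    by (simp add: image_image)
  then have "closed ?S" "convex ?S" "?S \<noteq> {}"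
    using assms subspace_imp_convex[OF assms(2)] subspace_0[OF assms(2)]
    by (auto simp only: closed_translation convex_translation closed_negations convex_negations
        image_is_empty)
  from min_norm_point_exists[OF this]
  obtain q where q: "q \<in> N" and min: "\<And>y. y \<in> N \<Longrightarrow> norm (x - q) \<le> norm (x - y)"
    by blast
  have "inner (x - q) y = 0" if y: "y \<in> N" for y
  proof (cases "y = 0")
    case False
    let ?i = "inner (x - q) y"
    define t where "t = ?i / inner y y"
    have "q + t *\<^sub>R y \<in> N"
      using q y assms(2) by (simp add: subspace_def)
    from min[OF this] have "(norm (x - q))\<^sup>2 \<le> (norm ((x - q) - t *\<^sub>R y))\<^sup>2"
      by (intro power_mono) (auto simp: algebra_simps)
    also have "\<dots> = (norm (x - q))\<^sup>2 - 2 * t * ?i + t\<^sup>2 * inner y y"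
      unfolding power2_norm_eq_inner by (simp add: inner_diff inner_commute power2_eq_square algebra_simps)
    also have "t\<^sup>2 * inner y y = t * ?i"
      using False by (simp add: t_def power2_eq_square)
    finally have "t * ?i \<le> 0" by simp
    then have "?i\<^sup>2 / inner y y \<le> 0" by (simp add: t_def power2_eq_square)
    moreover have "inner y y > 0" using False by simp
    ultimately show ?thesis by (auto simp: divide_le_0_iff)
  qed simp
  with q show ?thesis by blast
qed

text \<open>
  A nonzero functional is determined up to a factor by its kernel, hence by a vector orthogonal to
  the kernel.
\<close>

lemma riesz_representation:
  fixes f :: "'a::{real_inner,complete_space} \<Rightarrow> real"
  assumes "bounded_linear f"
  shows "\<exists>z. \<forall>x. f x = inner z x"
proof (cases "\<exists>x. f x \<noteq> 0")
  case True
  then obtain x where x: "f x \<noteq> 0" by blast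
  interpret f: bounded_linear f by fact
  have "closed {x. f x = 0}"
    by (intro closed_Collect_eq continuous_intros f.continuous_on)
  moreover have "subspace {x. f x = 0}"
    by (simp add: subspace_def f.add f.scaleR f.zero)
  ultimately obtain q where q: "f q = 0" and orth: "\<And>y. f y = 0 \<Longrightarrow> inner (x - q) y = 0"
    using orthogonal_decomposition[of "{x. f x = 0}" x] by blast
  define u where "u = x - q"
  have fu: "f u \<noteq> 0" using x q by (simp add: u_def f.diff)
  then have u: "inner u u \<noteq> 0" using f.zero by auto
  have "f y = inner ((f u / inner u u) *\<^sub>R u) y" for y
  proof -
    have "f (y - (f y / f u) *\<^sub>R u) = 0" using fu by (simp add: f.diff f.scaleR)
    from orth[OF this] have "inner u y = (f y / f u) * inner u u"
      by (simp add: u_def[symmetric] inner_diff)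
    then show ?thesis using fu u by simp
  qed
  then show ?thesis by blast
qed (auto intro: exI[where x = 0])

lemma real_adjoint_exists:
  fixes T :: "'a::{real_inner,complete_space} \<Rightarrow>\<^sub>L 'a"
  shows "\<exists>S :: 'a \<Rightarrow>\<^sub>L 'a. \<forall>x y. inner (S x) y = inner x (T y)"
proof -
  have "\<exists>z. \<forall>y. inner x (T y) = inner z y" for x
    using riesz_representation[OF bounded_linear_compose[OF bounded_linear_inner_right[of x]
          blinfun.bounded_linear_right[of T]]] .
  then have "\<forall>x. \<exists>z. \<forall>y. inner x (T y) = inner z y"
    by blast
  from choice[OF this] obtain S where S: "\<And>x y. inner (S x) y = inner x (T y)"
    by metis
  have "bounded_linear S"
  proof (rule bounded_linear_intro[where K = "norm T"])
    show "S (x + y) = S x + S y" for x y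
      by (rule vector_eq_rdot[THEN iffD1]) (simp add: S inner_add)
    show "S (r *\<^sub>R x) = r *\<^sub>R S x" for r x
      by (rule vector_eq_rdot[THEN iffD1]) (simp add: S)
    show "norm (S x) \<le> norm x * norm T" for x
    proof (cases "S x = 0")
      case False
      have "norm (S x) * norm (S x) = inner x (T (S x))"
        by (simp flip: S add: power2_norm_eq_inner[symmetric] power2_eq_square)
      also have "\<dots> \<le> norm x * norm (T (S x))"
        by (rule norm_cauchy_schwarz)
      also have "\<dots> \<le> norm x * (norm T * norm (S x))"
        by (intro mult_left_mono norm_blinfun) auto
      finally show ?thesis using False by simp
    qed simp
  qed
  then have "\<forall>x y. inner (Blinfun S x) y = inner x (T y)"
    by (simp add: bounded_linear_Blinfun_apply S)
  then show ?thesis by blast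
qed

section \<open>Operators on a complex Hilbert space\<close>

lemma inner_scaleC_left: "inner (c *\<^sub>C x) y = inner x (cnj c *\<^sub>C y)" for x y :: "'h::complex_hilbert"
  by (simp flip: Re_cinner add: cinner_scaleC_left cinner_scaleC_right)

text \<open>
  The imaginary part of the complex inner product is again a real inner product, so identities
  between complex-linear operators only have to be checked for the real inner product.
\<close>

lemma cinner_conv_inner:
  "cinner x y = Complex (inner x y) (inner x (\<i> *\<^sub>C y))" for x y :: "'h::complex_hilbert"
  by (simp flip: Re_cinner add: cinner_scaleC_right complex_eq_iff)

lemma scaleC_zero [simp]: "c *\<^sub>C 0 = (0 :: 'h::complex_hilbert)"
  using norm_scaleC[of c "0::'h"] by simp

lemma scaleC_diff_right: "c *\<^sub>C (x - y) = c *\<^sub>C x - c *\<^sub>C y" for x y :: "'h::complex_hilbert"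
  by (metis add_diff_cancel_right' diff_add_cancel scaleC_add_right)

lemma bounded_opsD: "T \<in> bounded_ops \<Longrightarrow> T (c *\<^sub>C x) = c *\<^sub>C T x"
  by (simp add: bounded_ops_def)

lemma scaleC_scaleR: "c *\<^sub>C (r *\<^sub>R x) = r *\<^sub>R (c *\<^sub>C x)" for x :: "'h::complex_hilbert"
  by (metis scaleC_of_real scaleC_scaleC mult.commute)

lemma bounded_ops_intros:
  "0 \<in> bounded_ops" "id_blinfun \<in> bounded_ops"
  "S \<in> bounded_ops \<Longrightarrow> T \<in> bounded_ops \<Longrightarrow> S + T \<in> bounded_ops"
  "S \<in> bounded_ops \<Longrightarrow> T \<in> bounded_ops \<Longrightarrow> S - T \<in> bounded_ops"
  "S \<in> bounded_ops \<Longrightarrow> T \<in> bounded_ops \<Longrightarrow> S o\<^sub>L T \<in> bounded_ops"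
  "T \<in> bounded_ops \<Longrightarrow> r *\<^sub>R T \<in> bounded_ops"
  by (simp_all add: bounded_ops_def blinfun.bilinear_simps scaleC_add_right scaleC_diff_right scaleC_scaleR)

lemma blinfun_ext_inner: "(\<And>x y. inner (S x) y = inner (T x) y) \<Longrightarrow> S = T"
  for S T :: "'a::real_inner \<Rightarrow>\<^sub>L 'a"
  by (rule blinfun_eqI, rule vector_eq_rdot[THEN iffD1]) simp

lemma adj_eqI:
  fixes S T :: "'h::complex_hilbert \<Rightarrow>\<^sub>L 'h"
  assumes T: "T \<in> bounded_ops" and S: "\<And>x y. inner (S x) y = inner x (T y)"
  shows "adj T = S"
  unfolding adj_def
proof (rule the_equality)
  show "\<forall>x y. cinner (S x) y = cinner x (T y)"
    using bounded_opsD[OF T, of "\<i>"] by (simp add: cinner_conv_inner S)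
next
  fix R assume "\<forall>x y. cinner (blinfun_apply R x) y = cinner x (blinfun_apply T y)"
  then have "inner (R x) y = inner x (T y)" for x y by (metis Re_cinner)
  then show "R = S" by (intro blinfun_ext_inner) (simp add: S)
qed

lemma inner_adj_left: "T \<in> bounded_ops \<Longrightarrow> inner (adj T x) y = inner x (T y)"
  using real_adjoint_exists[of T] adj_eqI[of T] by metis

lemma inner_adj_right: "T \<in> bounded_ops \<Longrightarrow> inner x (adj T y) = inner (T x) y"
  by (metis inner_adj_left inner_commute)

lemma adj_in_bounded_ops: "T \<in> bounded_ops \<Longrightarrow> adj T \<in> bounded_ops"
  unfolding bounded_ops_def mem_Collect_eq
proof (intro allI)
  fix c x assume "\<forall>c x. T (c *\<^sub>C x) = c *\<^sub>C T x"
  then have T: "T \<in> bounded_ops" by (simp add: bounded_ops_def)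
  show "adj T (c *\<^sub>C x) = c *\<^sub>C adj T x"
    by (rule vector_eq_rdot[THEN iffD1]) (simp add: inner_adj_left[OF T] inner_scaleC_left bounded_opsD[OF T])
qed

lemma adj_adj: "T \<in> bounded_ops \<Longrightarrow> adj (adj T) = T"
  by (rule adj_eqI) (auto simp: adj_in_bounded_ops inner_adj_right)

lemma adj_compose:
  "S \<in> bounded_ops \<Longrightarrow> T \<in> bounded_ops \<Longrightarrow> adj (S o\<^sub>L T) = adj T o\<^sub>L adj S"
  by (rule adj_eqI) (auto simp: bounded_ops_intros inner_adj_left)

lemma adj_zero [simp]: "adj 0 = 0"
  by (rule adj_eqI) (auto simp: bounded_ops_intros)

lemma compose_eq_0_adj:
  "S \<in> bounded_ops \<Longrightarrow> T \<in> bounded_ops \<Longrightarrow> S o\<^sub>L T = 0 \<longleftrightarrow> adj T o\<^sub>L adj S = 0"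
  by (metis adj_adj adj_compose adj_in_bounded_ops adj_zero)

lemma self_adjoint_iff:
  "self_adjoint T \<longleftrightarrow> T \<in> bounded_ops \<and> (\<forall>x y. inner (T x) y = inner x (T y))"
  unfolding self_adjoint_def by (metis adj_eqI inner_adj_left)

lemma positive_op_iff: "positive_op T \<longleftrightarrow> self_adjoint T \<and> (\<forall>x. 0 \<le> inner (T x) x)"
proof -
  have "cinner (T x) x \<in> \<real>\<^sub>\<ge>\<^sub>0 \<longleftrightarrow> 0 \<le> inner (T x) x" if "self_adjoint T" for x
  proof -
    have "cinner (T x) x = cinner x (T x)"
      using that by (simp add: self_adjoint_iff cinner_conv_inner flip: bounded_opsD)
    then have "Im (cinner (T x) x) = 0"
      by (metis cinner_commute complex_cnj_cancel_iff Im_complex_of_real Reals_cases Reals_cnj_iff)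
    then show ?thesis by (simp add: complex_nonneg_Reals_iff Re_cinner)
  qed
  then show ?thesis unfolding positive_op_def by blast
qed

lemma self_adjoint_diff: "self_adjoint S \<Longrightarrow> self_adjoint T \<Longrightarrow> self_adjoint (S - T)"
  by (simp add: self_adjoint_iff bounded_ops_intros blinfun.diff_left inner_diff)

lemma op_le_iff:
  "self_adjoint S \<Longrightarrow> self_adjoint T \<Longrightarrow> S \<preceq> T \<longleftrightarrow> (\<forall>x. inner (S x) x \<le> inner (T x) x)"
  by (simp add: op_le_def positive_op_iff self_adjoint_diff blinfun.diff_left inner_diff)

text \<open>
  For \<open>k > 0\<close> evaluate the positive form of \<open>T\<close> at \<open>x - Tx/k\<close>: this replaces the Cauchy-Schwarz
  inequality for the form. The case \<open>k = 0\<close> is the limit of positive \<open>k\<close>.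
\<close>

lemma norm_le_form_bound:
  assumes T: "positive_op T" and k: "\<And>x. inner (T x) x \<le> k * (norm x)\<^sup>2" and "0 \<le> k"
  shows "norm T \<le> k"
proof -
  have pos: "norm T \<le> k" if k: "\<And>x. inner (T x) x \<le> k * (norm x)\<^sup>2" and "0 < k" for k
  proof (rule norm_blinfun_bound)
    fix x
    let ?y = "T x"
    have sa: "inner (T u) v = inner u (T v)" for u v
      using T by (simp add: positive_op_iff self_adjoint_iff)
    have normT: "inner x (T ?y) = norm ?y * norm ?y"
      by (simp flip: sa power2_eq_square add: power2_norm_eq_inner)
    have "0 \<le> inner (T (x - (1/k) *\<^sub>R ?y)) (x - (1/k) *\<^sub>R ?y)"
      using T by (simp add: positive_op_iff)
    also have "\<dots> = inner (T x) x - 2 * (1/k) * (norm ?y)\<^sup>2 + (1/k)\<^sup>2 * inner (T ?y) ?y"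
      using normT by (simp add: blinfun.bilinear_simps inner_diff sa power2_eq_square algebra_simps)
    also have "\<dots> \<le> k * (norm x)\<^sup>2 - 2 * (1/k) * (norm ?y)\<^sup>2 + (1/k)\<^sup>2 * (k * (norm ?y)\<^sup>2)"
      by (intro add_mono diff_mono mult_left_mono k order_refl) (use \<open>0 < k\<close> in auto)
    also have "\<dots> = k * (norm x)\<^sup>2 - (1/k) * (norm ?y)\<^sup>2"
      using \<open>0 < k\<close> by (simp add: power2_eq_square field_simps)
    finally have "(norm ?y)\<^sup>2 \<le> (k * norm x)\<^sup>2"
      using \<open>0 < k\<close> by (simp add: field_simps power2_eq_square)
    then show "norm ?y \<le> k * norm x"
      by (rule power2_le_imp_le) (use \<open>0 < k\<close> in auto)
  qed (use \<open>0 < k\<close> in linarith)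
  have "norm T \<le> k + e" if "0 < e" for e
  proof (rule pos)
    show "inner (T x) x \<le> (k + e) * (norm x)\<^sup>2" for x
      using k[of x] mult_right_mono[of k "k + e" "(norm x)\<^sup>2"] that by simp
  qed (use that \<open>0 \<le> k\<close> in simp)
  then show ?thesis by (rule field_le_epsilon)
qed

text \<open>
  Two suprema dominate each other, so the form of their difference vanishes, and with it the norm
  of the difference. This is what makes suprema unique.
\<close>

lemma op_sup_eqI: "is_op_sup D T \<Longrightarrow> op_sup D = T"
  unfolding op_sup_def
proof (rule the_equality)
  fix R assume "is_op_sup D T" "is_op_sup D R"
  then have "R \<preceq> T" "T \<preceq> R" by (auto simp: is_op_sup_def)
  then have "positive_op (T - R)" and "\<And>x. inner ((T - R) x) x \<le> 0 * (norm x)\<^sup>2"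
    by (auto simp: op_le_def positive_op_iff blinfun.diff_left inner_diff)
  then have "norm (T - R) \<le> 0" by (rule norm_le_form_bound) simp
  then show "R = T" by simp
qed

lemma projection_iff:
  "projection p \<longleftrightarrow> self_adjoint p \<and> (\<forall>x. p (p x) = p x)"
proof -
  have "p o\<^sub>L p = p \<longleftrightarrow> (\<forall>x. p (p x) = p x)"
    by (auto dest: arg_cong[where f = blinfun_apply] fun_cong intro: blinfun_eqI simp flip: blinfun_apply_blinfun_compose)
  then show ?thesis by (simp add: projection_def)
qed

lemma cstar_algebraD:
  assumes "cstar_algebra B"
  shows "b \<in> B \<Longrightarrow> b \<in> bounded_ops" "0 \<in> B" "a \<in> B \<Longrightarrow> b \<in> B \<Longrightarrow> a + b \<in> B"
    "a \<in> B \<Longrightarrow> b \<in> B \<Longrightarrow> a o\<^sub>L b \<in> B" "b \<in> B \<Longrightarrow> adj b \<in> B" "closed B"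
    and cstar_scaleR: "b \<in> B \<Longrightarrow> r *\<^sub>R b \<in> B"
    and cstar_diff: "a \<in> B \<Longrightarrow> b \<in> B \<Longrightarrow> a - b \<in> B"
proof -
  have s: "scaleC_op (complex_of_real r) b = r *\<^sub>R b" for r and b :: "'a \<Rightarrow>\<^sub>L 'a"
    by (rule blinfun_eqI) (simp add: scaleC_op.rep_eq scaleC_of_real blinfun.scaleR_left)
  show R: "r *\<^sub>R b \<in> B" if "b \<in> B" for r b
    using assms that by (metis cstar_algebra_def s)
  show "a - b \<in> B" if "a \<in> B" "b \<in> B" for a b
    using assms that R[of b "-1"] unfolding cstar_algebra_def by (metis scaleR_minus1_left add_uminus_conv_diff)
qed (use assms in \<open>auto simp: cstar_algebra_def\<close>)

section \<open>An approximate unit\<close>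

text \<open>
  The equation says \<open>x = c(1 + c)\<^sup>-\<^sup>1\<close>. For \<open>t = 1 / (1 + norm c)\<close> the operator
  \<open>1 - t(1 + c)\<close> is positive with norm at most \<open>1 - t < 1\<close>, so iterating
  \<open>x \<mapsto> tc + (1 - t(1 + c))x\<close> converges, and it does not leave the closed set \<open>B\<close> even if \<open>B\<close> has no
  unit.
\<close>

lemma bounded_transform_exists:
  assumes B: "cstar_algebra B" and c: "c \<in> B" "positive_op c"
  shows "\<exists>x\<in>B. x + (c o\<^sub>L x) = c"
proof -
  define t where "t = 1 / (1 + norm c)"
  have "0 < 1 + norm c" by (simp add: add_pos_nonneg)
  then have t: "0 < t" "t \<le> 1" "t * norm c = 1 - t"
    by (simp_all add: t_def field_simps)
  define T where "T = (1 - t) *\<^sub>R id_blinfun - t *\<^sub>R c"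
  define f where "f x = t *\<^sub>R c + (x - t *\<^sub>R (x + (c o\<^sub>L x)))" for x
  have cb: "c \<in> bounded_ops" and sa: "inner (c u) v = inner u (c v)" and pos: "0 \<le> inner (c u) u" for u v
    using c(2) by (auto simp: positive_op_iff self_adjoint_iff)
  have upper: "inner (c u) u \<le> norm c * inner u u" for u
  proof -
    have "inner (c u) u \<le> norm (c u) * norm u" by (rule norm_cauchy_schwarz)
    also have "\<dots> \<le> (norm c * norm u) * norm u" by (intro mult_right_mono norm_blinfun) auto
    finally show ?thesis by (simp add: power2_norm_eq_inner[symmetric] power2_eq_square mult.assoc)
  qed
  have form: "inner (T u) u = (1 - t) * inner u u - t * inner (c u) u" for u
    by (simp add: T_def blinfun.bilinear_simps inner_diff)
  have "norm T \<le> 1 - t"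
  proof (rule norm_le_form_bound)
    have "0 \<le> inner (T u) u" for u
    proof -
      have "t * inner (c u) u \<le> t * (norm c * inner u u)"
        using t upper by (intro mult_left_mono) auto
      also have "\<dots> = (1 - t) * inner u u"
        by (simp add: t(3) flip: mult.assoc)
      finally show ?thesis by (simp add: form)
    qed
    then show "positive_op T"
      by (simp add: positive_op_iff self_adjoint_iff T_def bounded_ops_intros cb blinfun.bilinear_simps
          inner_diff sa)
    show "inner (T u) u \<le> (1 - t) * (norm u)\<^sup>2" for u
      using t pos[of u] by (simp add: form power2_norm_eq_inner)
  qed (use t in auto)
  then have contr: "dist (f x) (f y) \<le> (1 - t) * dist x y" for x y
  proof -
    have "f x - f y = T o\<^sub>L (x - y)"
      by (rule blinfun_eqI) (simp add: f_def T_def blinfun.bilinear_simps algebra_simps)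
    then have "dist (f x) (f y) \<le> norm T * norm (x - y)"
      by (simp add: dist_norm norm_blinfun_compose)
    also have "\<dots> \<le> (1 - t) * dist x y"
      using \<open>norm T \<le> 1 - t\<close> by (simp add: dist_norm mult_right_mono)
    finally show ?thesis .
  qed
  have "\<exists>!x. x \<in> B \<and> f x = x"
  proof (rule Banach_fix[of B "1 - t" f])
    show "complete B" using cstar_algebraD(6)[OF B] by (simp add: complete_eq_closed)
    show "B \<noteq> {}" using c by blast
    show "f ` B \<subseteq> B"
      using c(1) by (auto simp: f_def intro!: cstar_algebraD[OF B] cstar_scaleR[OF B] cstar_diff[OF B])
  qed (use t contr in auto)
  then obtain x where "x \<in> B" "f x = x" by blast
  then have "t *\<^sub>R (x + (c o\<^sub>L x)) = t *\<^sub>R c" by (simp add: f_def algebra_simps)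
  then have "x + (c o\<^sub>L x) = c" using t(1) by simp
  with \<open>x \<in> B\<close> show ?thesis by blast
qed

text \<open>
  These are the elements \<open>c(1 + c)\<^sup>-\<^sup>1\<close>. As a set indexed by positive \<open>c\<close> it is visibly directed,
  whereas directedness of the open unit ball would need the inverse transform as well.
\<close>

definition approx_unit :: "('h::complex_hilbert \<Rightarrow>\<^sub>L 'h) set \<Rightarrow> ('h \<Rightarrow>\<^sub>L 'h) set" where
  "approx_unit B = {x \<in> B. \<exists>c\<in>B. positive_op c \<and> x + (c o\<^sub>L x) = c}"

text \<open>
  That is, \<open>1 - x\<close> is a right inverse of \<open>1 + c\<close>. The order properties below substitute \<open>w = (1 + c)v\<close>
  with \<open>v = (1 - x)w\<close>.
\<close>

lemma one_minus_bounded_transform: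
  assumes "x + (c o\<^sub>L x) = c"
  shows "(w - x w) + c (w - x w) = w"
proof -
  have "x w + c (x w) = c w"
    using arg_cong[OF assms, of "\<lambda>T. T w"] by (simp add: blinfun.add_left)
  then show ?thesis by (simp add: blinfun.diff_right algebra_simps)
qed

lemma bounded_transform_properties:
  assumes x: "x \<in> bounded_ops" and c: "positive_op c" and eq: "x + (c o\<^sub>L x) = c"
  shows "positive_op x" "inner (x w) w \<le> inner w w" "norm x \<le> 1"
proof -
  have c': "inner (c u) v = inner u (c v)" "0 \<le> inner (c u) u" for u v
    using c by (auto simp: positive_op_iff self_adjoint_iff)
  define r where "r w = w - x w" for w
  have r: "r w + c (r w) = w" for w
    unfolding r_def by (rule one_minus_bounded_transform[OF eq])
  have "inner (r u) v = inner u (r v)" for u v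
  proof -
    have "inner (r u) v = inner (r u) (r v + c (r v))" by (simp only: r)
    also have "\<dots> = inner (r u + c (r u)) (r v)" by (simp add: inner_add c')
    finally show ?thesis by (simp only: r)
  qed
  then have sa: "inner (x u) v = inner u (x v)" for u v
    by (simp add: r_def inner_diff)
  have "0 \<le> inner (r w) w" for w
  proof -
    have "inner (r w) w = inner (r w) (r w + c (r w))" by (simp only: r)
    also have "\<dots> = inner (r w) (r w) + inner (c (r w)) (r w)" by (simp add: inner_add c')
    finally show ?thesis using c'(2)[of "r w"] by (simp add: c'(1))
  qed
  then show le: "inner (x w) w \<le> inner w w" for w
    by (simp add: r_def inner_diff)
  have "0 \<le> inner (x w) w" for w
  proof -
    have "x w = c (r w)" using r[of w] by (simp add: r_def algebra_simps)
    then have "inner (x w) w = inner (c (r w)) (r w + c (r w))" by (simp only: r)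
    also have "\<dots> = inner (c (r w)) (r w) + inner (c (r w)) (c (r w))"
      by (rule inner_add_right)
    finally show ?thesis using c'(2)[of "r w"] by simp
  qed
  with x sa show pos: "positive_op x"
    by (simp add: positive_op_iff self_adjoint_iff)
  show "norm x \<le> 1"
    using pos by (rule norm_le_form_bound) (auto simp: power2_norm_eq_inner le)
qed

text \<open>
  Equivalently, inversion reverses the order of \<open>1 + c\<close> and \<open>1 + d\<close>. With \<open>w = (1 + c)v = (1 + d)u\<close>,
  the form of \<open>1 + c\<close> at \<open>u - v\<close> is nonnegative, and replacing \<open>c\<close> by \<open>d\<close> in its \<open>u\<close>-part
  turns this into \<open>inner w u \<le> inner w v\<close>.
\<close>

lemma bounded_transform_mono:
  assumes x: "x \<in> bounded_ops" and c: "positive_op c" and eqx: "x + (c o\<^sub>L x) = c"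
    and y: "y \<in> bounded_ops" and d: "positive_op d" and eqy: "y + (d o\<^sub>L y) = d" and le: "c \<preceq> d"
  shows "x \<preceq> y"
proof -
  have "inner (x w) w \<le> inner (y w) w" for w
  proof -
    define u where "u = w - y w"
    define v where "v = w - x w"
    have u: "u + d u = w" and v: "v + c v = w"
      unfolding u_def v_def by (rule one_minus_bounded_transform eqx eqy)+
    have c': "inner (c a) b = inner a (c b)" "0 \<le> inner (c a) a" for a b
      using c by (auto simp: positive_op_iff self_adjoint_iff)
    have sym: "inner u (c v) = inner v (c u)" "inner u v = inner v u"
      by (metis c'(1) inner_commute)+
    have cd: "inner (c a) a \<le> inner (d a) a" for a
      using le c d by (simp add: op_le_iff positive_op_iff)
    have "0 \<le> inner ((u - v) + c (u - v)) (u - v)"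
      using c'(2)[of "u - v"] by (simp add: inner_add)
    also have "\<dots> = inner (u + c u) u - 2 * inner (v + c v) u + inner (v + c v) v"
      using sym by (simp add: blinfun.diff_right inner_add inner_diff c'(1))
    also have "\<dots> \<le> inner (u + d u) u - 2 * inner (v + c v) u + inner (v + c v) v"
      using cd[of u] by (simp add: inner_add)
    finally have "inner w u \<le> inner w v" by (simp add: u v)
    then show ?thesis by (simp add: u_def v_def inner_diff inner_commute)
  qed
  then show ?thesis
    using bounded_transform_properties(1)[OF x c eqx] bounded_transform_properties(1)[OF y d eqy]
    by (simp add: op_le_iff positive_op_iff)
qed

lemma positive_op_add: "positive_op c \<Longrightarrow> positive_op d \<Longrightarrow> positive_op (c + d)"
  unfolding positive_op_iff
  by (auto simp: self_adjoint_iff bounded_ops_intros blinfun.add_left inner_add_left inner_add_right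
      intro: add_nonneg_nonneg)

lemma positive_op_scaleR_mult_adj:
  assumes b: "b \<in> bounded_ops" and r: "0 \<le> (r::real)"
  shows "positive_op (r *\<^sub>R (b o\<^sub>L adj b))"
proof -
  have "inner (b (adj b x)) y = inner x (b (adj b y))" for x y
    by (metis b inner_adj_right inner_adj_left)
  moreover have "0 \<le> inner (b (adj b x)) x" for x
    by (metis b inner_adj_right inner_ge_zero)
  ultimately show ?thesis
    using r b by (simp add: positive_op_iff self_adjoint_iff bounded_ops_intros adj_in_bounded_ops
        blinfun.scaleR_left)
qed

lemma approx_unit_properties:
  assumes B: "cstar_algebra B" and x: "x \<in> approx_unit B"
  shows "x \<in> pos_unit_ball B" "inner (x w) w \<le> inner w w"
  using assms bounded_transform_properties cstar_algebraD(1)[OF B]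
  unfolding approx_unit_def pos_unit_ball_def by blast+

lemma approx_unit_directed:
  assumes B: "cstar_algebra B" and x: "x \<in> approx_unit B" and y: "y \<in> approx_unit B"
  shows "\<exists>z\<in>approx_unit B. x \<preceq> z \<and> y \<preceq> z"
proof -
  obtain c d where c: "c \<in> B" "positive_op c" "x + (c o\<^sub>L x) = c" "x \<in> bounded_ops"
    and d: "d \<in> B" "positive_op d" "y + (d o\<^sub>L y) = d" "y \<in> bounded_ops"
    using x y B by (auto simp: approx_unit_def dest: cstar_algebraD(1))
  have cd: "c + d \<in> B" "positive_op (c + d)"
    using c d B by (auto intro: cstar_algebraD positive_op_add)
  obtain z where z: "z \<in> B" "z + ((c + d) o\<^sub>L z) = c + d"
    using bounded_transform_exists[OF B cd] by blast
  have "c \<preceq> c + d" "d \<preceq> c + d" using c d by (auto simp: op_le_def)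
  then have "x \<preceq> z" "y \<preceq> z"
    using bounded_transform_mono c d cd z cstar_algebraD(1)[OF B z(1)] by blast+
  then show ?thesis using z cd by (auto simp: approx_unit_def)
qed

text \<open>
  Take \<open>c = n bb*\<close> and \<open>w = (1 + c)\<^sup>-\<^sup>1by\<close>. Then \<open>inner w (by)\<close> is at least
  \<open>n norm(b*w)\<^sup>2\<close> and at most \<open>norm(b*w) norm y\<close>, hence at most \<open>norm(y)\<^sup>2 / n\<close>. No square roots of
  operators are needed.
\<close>

lemma approx_unit_approximates_range:
  assumes B: "cstar_algebra B" and b: "b \<in> B" and e: "0 < e"
  shows "\<exists>x\<in>approx_unit B. inner (b y - x (b y)) (b y) < e"
proof -
  have bb: "b \<in> bounded_ops" using B b by (rule cstar_algebraD)
  define n where "n = (norm y)\<^sup>2 / e + 1"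
  have "(norm y)\<^sup>2 / e < n" "0 \<le> (norm y)\<^sup>2 / e" using e by (auto simp: n_def)
  then have n: "0 < n" and "(norm y)\<^sup>2 < n * e"
    using e by (linarith, simp add: field_simps)
  then have small: "(norm y)\<^sup>2 / n < e"
    by (simp add: field_simps)
  define c where "c = n *\<^sub>R (b o\<^sub>L adj b)"
  have c: "c \<in> B" "positive_op c"
    using b n B by (auto simp: c_def bb intro!: cstar_scaleR cstar_algebraD positive_op_scaleR_mult_adj)
  obtain x where x: "x \<in> B" "x + (c o\<^sub>L x) = c"
    using bounded_transform_exists[OF B c] by blast
  define w where "w = b y - x (b y)"
  have w: "w + c w = b y"
    unfolding w_def by (rule one_minus_bounded_transform[OF x(2)])
  let ?m = "norm (adj b w)"
  have upper: "inner w (b y) \<le> ?m * norm y"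
    using norm_cauchy_schwarz[of "adj b w" y] by (simp add: inner_adj_left[OF bb])
  have "inner w (b y) = inner w w + n * ?m\<^sup>2"
    by (simp flip: w inner_adj_left[OF bb]
        add: inner_add c_def blinfun.scaleR_left power2_norm_eq_inner)
  then have lower: "n * ?m\<^sup>2 \<le> inner w (b y)" by simp
  have "?m \<le> norm y / n"
  proof (cases "?m = 0")
    case False
    then have "n * ?m \<le> norm y"
      using order_trans[OF lower upper] by (simp add: power2_eq_square)
    then show ?thesis using n by (simp add: field_simps)
  qed (use n in auto)
  then have "?m * norm y \<le> (norm y / n) * norm y"
    by (rule mult_right_mono) simp
  with upper small have "inner w (b y) < e" by (simp add: power2_eq_square)
  then show ?thesis using x c by (auto simp: w_def approx_unit_def)
qed

text \<open>
  The residual \<open>x \<mapsto> x - q\<close> of the orthogonal decomposition along \<open>N\<close>; uniqueness of the decomposition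
  makes it linear, also over the complex numbers. It is the projection with kernel \<open>N\<close>.
\<close>

lemma orthogonal_projection_exists:
  fixes N :: "'h::complex_hilbert set"
  assumes "closed N" "subspace N" and C: "\<And>c x. x \<in> N \<Longrightarrow> c *\<^sub>C x \<in> N"
  shows "\<exists>p. projection p \<and> (\<forall>w. p w = 0 \<longleftrightarrow> w \<in> N)"
proof -
  have "\<exists>r. x - r \<in> N \<and> (\<forall>y\<in>N. inner r y = 0)" for x
  proof -
    obtain q where "q \<in> N" "\<forall>y\<in>N. inner (x - q) y = 0"
      using orthogonal_decomposition[OF assms(1,2)] by blast
    then show ?thesis by (intro exI[of _ "x - q"]) simp
  qed
  then have "\<forall>x. \<exists>r. x - r \<in> N \<and> (\<forall>y\<in>N. inner r y = 0)" by blast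
  from choice[OF this] obtain r where r: "\<And>x. x - r x \<in> N" "\<And>x y. y \<in> N \<Longrightarrow> inner (r x) y = 0"
    by blast
  have unique: "r x = z" if "x - z \<in> N" "\<And>y. y \<in> N \<Longrightarrow> inner z y = 0" for x z
  proof -
    have "r x - z \<in> N"
      using subspace_diff[OF assms(2) that(1) r(1)[of x]] by simp
    then have "inner (r x - z) (r x - z) = 0"
      using r(2) that(2) by (simp add: inner_diff_left)
    then show ?thesis by simp
  qed
  have "bounded_linear r"
  proof (rule bounded_linear_intro[where K = 1])
    show "r (x + y) = r x + r y" for x y
    proof (rule unique)
      have "(x - r x) + (y - r y) \<in> N" by (intro subspace_add[OF assms(2)] r)
      then show "x + y - (r x + r y) \<in> N" by (simp add: algebra_simps)
    qed (simp add: r inner_add)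
    show "r (a *\<^sub>R x) = a *\<^sub>R r x" for a x
    proof (rule unique)
      have "a *\<^sub>R (x - r x) \<in> N" by (intro subspace_scale[OF assms(2)] r)
      then show "a *\<^sub>R x - a *\<^sub>R r x \<in> N" by (simp add: algebra_simps)
    qed (simp add: r)
    show "norm (r x) \<le> norm x * 1" for x
    proof -
      have "inner (r x) (x - r x) = 0" using r by blast
      then have "norm (r x) * norm (r x) = inner (r x) x"
        by (simp add: inner_diff power2_norm_eq_inner flip: power2_eq_square)
      also have "\<dots> \<le> norm (r x) * norm x" by (rule norm_cauchy_schwarz)
      finally show ?thesis by (cases "r x = 0") auto
    qed
  qed
  then obtain p where p: "blinfun_apply p = r"
    using bounded_linear_Blinfun_apply by blast
  have "r (c *\<^sub>C x) = c *\<^sub>C r x" for c x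
    using C[OF r(1)[of x], of c] C by (intro unique) (auto simp: scaleC_diff_right inner_scaleC_left r)
  then have "p \<in> bounded_ops" by (simp add: bounded_ops_def p)
  moreover have "inner (r x) y = inner x (r y)" for x y
  proof -
    have "inner (r x) (y - r y) = 0" "inner (r y) (x - r x) = 0" using r by auto
    then show ?thesis by (simp add: inner_diff inner_commute)
  qed
  moreover have "r (r x) = r x" for x
    by (rule unique) (simp_all add: r subspace_0[OF assms(2)])
  moreover have "r w = 0 \<longleftrightarrow> w \<in> N" for w
    using r(1)[of w] unique[of w 0] by auto
  ultimately show ?thesis
    by (intro exI[of _ p]) (simp add: projection_iff self_adjoint_iff p)
qed

section \<open>The support projection of a C*-algebra\<close>

text \<open>
  The orthogonal complement of \<open>BH\<close> when \<open>B\<close> is closed under adjoints. Describing \<open>p\<^sub>B\<close> by its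
  kernel avoids closed spans.
\<close>

definition common_kernel :: "('h::complex_hilbert \<Rightarrow>\<^sub>L 'h) set \<Rightarrow> 'h set" where
  "common_kernel B = {w. \<forall>b\<in>B. b w = 0}"

lemma support_projection_exists:
  assumes "B \<subseteq> bounded_ops"
  shows "\<exists>p. projection p \<and> (\<forall>w. p w = 0 \<longleftrightarrow> w \<in> common_kernel B)"
proof (rule orthogonal_projection_exists)
  have "common_kernel B = (\<Inter>b\<in>B. {w. blinfun_apply b w = 0})"
    by (auto simp: common_kernel_def)
  also have "closed \<dots>"
    by (intro closed_INT ballI closed_Collect_eq continuous_intros)
  finally show "closed (common_kernel B)" .
  show "subspace (common_kernel B)"
    by (simp add: subspace_def common_kernel_def blinfun.bilinear_simps)
  show "c *\<^sub>C x \<in> common_kernel B" if "x \<in> common_kernel B" for c x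
    using assms that by (auto simp: common_kernel_def bounded_opsD)
qed

lemma projectionD:
  assumes "projection p"
  shows "p \<in> bounded_ops" "inner (p x) y = inner x (p y)" "p (p x) = p x" "adj p = p"
    "p o\<^sub>L p = p" "self_adjoint p"
proof -
  show "self_adjoint p" "p o\<^sub>L p = p" using assms by (simp_all add: projection_def)
  then show "adj p = p" "p \<in> bounded_ops" by (simp_all add: self_adjoint_def)
  show "inner (p x) y = inner x (p y)" "p (p x) = p x"
    using assms by (simp_all add: projection_iff self_adjoint_iff)
qed

text \<open>
  The vectors that are approximated form a closed subspace \<open>W\<close>: directedness gives a common
  approximant for two vectors, and monotonicity keeps the errors small. \<open>W\<close> contains \<open>BH\<close>, so its
  orthogonal complement lies in the common kernel of \<open>B\<close>, which is orthogonal to \<open>z = pz\<close>. Hence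
  \<open>z \<in> W\<close>.
\<close>

lemma approx_unit_approximates_support:
  assumes B: "cstar_algebra B" and p: "projection p" and ker: "\<And>w. p w = 0 \<longleftrightarrow> w \<in> common_kernel B"
    and z: "p z = z" and e: "0 < e"
  shows "\<exists>x\<in>approx_unit B. inner (z - x z) z < e"
proof -
  define W where "W = {z. \<forall>e>0. \<exists>x\<in>approx_unit B. inner (z - x z) z < e}"
  have pos: "0 \<le> inner (w - x w) w" and sa: "inner (x u) w = inner u (x w)"
    and small: "inner (w - x w) w \<le> inner w w" if "x \<in> approx_unit B" for x u w
    using approx_unit_properties[OF B that]
    by (auto simp: pos_unit_ball_def positive_op_iff self_adjoint_iff inner_diff)
  \<comment> \<open>The parallelogram identity for the form of \<open>1 - x\<close>, dropping its value at \<open>u - w\<close>.\<close>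
  have quad: "inner ((u + w) - x (u + w)) (u + w) \<le> 2 * inner (u - x u) u + 2 * inner (w - x w) w"
    if "x \<in> approx_unit B" for x u w
    using pos[OF that, of "u - w"]
    by (simp add: blinfun.bilinear_simps inner_diff inner_add inner_commute algebra_simps)
  have mono: "inner (w - y w) w \<le> inner (w - x w) w" if "x \<preceq> y" for x y w
    using that by (simp add: op_le_def positive_op_iff blinfun.diff_left inner_diff)
  have range: "b y \<in> W" if "b \<in> B" for b y
    using approx_unit_approximates_range[OF B that] by (simp add: W_def)
  have "subspace W"
    unfolding subspace_def
  proof (intro conjI ballI allI)
    show "0 \<in> W" using range[OF cstar_algebraD(2)[OF B], of 0] by simp
  next
    fix u w assume uw: "u \<in> W" "w \<in> W"
    show "u + w \<in> W"
      unfolding W_def mem_Collect_eq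
    proof (intro allI impI)
      fix e :: real assume "0 < e"
      then have "0 < e / 4" by simp
      with uw obtain x y where x: "x \<in> approx_unit B" "inner (u - x u) u < e / 4"
        and y: "y \<in> approx_unit B" "inner (w - y w) w < e / 4"
        unfolding W_def by blast
      obtain v where v: "v \<in> approx_unit B" "x \<preceq> v" "y \<preceq> v"
        using approx_unit_directed[OF B x(1) y(1)] by blast
      have "inner ((u + w) - v (u + w)) (u + w) < e"
        using quad[OF v(1), of u w] mono[OF v(2), of u] mono[OF v(3), of w] x(2) y(2) by linarith
      with v(1) show "\<exists>x\<in>approx_unit B. inner ((u + w) - x (u + w)) (u + w) < e" by blast
    qed
  next
    fix a :: real and w assume w: "w \<in> W"
    show "a *\<^sub>R w \<in> W"
      unfolding W_def mem_Collect_eq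
    proof (intro allI impI)
      fix e :: real assume "0 < e"
      have a: "0 < a\<^sup>2 + 1" by (simp add: add_nonneg_pos)
      with \<open>0 < e\<close> have "0 < e / (a\<^sup>2 + 1)" by simp
      with w obtain x where x: "x \<in> approx_unit B" "inner (w - x w) w < e / (a\<^sup>2 + 1)"
        unfolding W_def by blast
      have "inner (a *\<^sub>R w - x (a *\<^sub>R w)) (a *\<^sub>R w) = a\<^sup>2 * inner (w - x w) w"
        by (simp add: blinfun.scaleR_right power2_eq_square flip: scaleR_diff_right)
      also have "\<dots> \<le> (a\<^sup>2 + 1) * inner (w - x w) w"
        using pos[OF x(1)] by (intro mult_right_mono) auto
      also have "\<dots> < e" using x(2) a by (simp add: field_simps)
      finally show "\<exists>x\<in>approx_unit B. inner (a *\<^sub>R w - x (a *\<^sub>R w)) (a *\<^sub>R w) < e"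
        using x(1) by blast
    qed
  qed
  have "closed W"
    unfolding closed_sequential_limits
  proof (intro allI impI)
    fix f l assume f: "(\<forall>n. f n \<in> W) \<and> f \<longlonglongrightarrow> l"
    show "l \<in> W"
      unfolding W_def mem_Collect_eq
    proof (intro allI impI)
      fix e :: real assume e: "0 < e"
      then have "0 < sqrt (e / 4)" by simp
      then obtain n where "dist (f n) l < sqrt (e / 4)"
        using f unfolding lim_sequentially by blast
      then have "(norm (l - f n))\<^sup>2 < (sqrt (e / 4))\<^sup>2"
        by (intro power_strict_mono) (auto simp: dist_norm norm_minus_commute)
      then have d: "inner (l - f n) (l - f n) < e / 4"
        using e by (simp add: power2_norm_eq_inner)
      have "f n \<in> W" "0 < e / 4" using f e by auto
      then obtain x where x: "x \<in> approx_unit B" "inner (f n - x (f n)) (f n) < e / 4"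
        unfolding W_def by blast
      \<comment> \<open>The form of \<open>1 - x\<close> at \<open>l\<close> is at most twice the sum of the forms at \<open>f n\<close> and \<open>l - f n\<close>.\<close>
      have "inner (l - x l) l < e"
        using quad[OF x(1), of "f n" "l - f n"] small[OF x(1), of "l - f n"] d x(2) by simp
      with x(1) show "\<exists>x\<in>approx_unit B. inner (l - x l) l < e" by blast
    qed
  qed
  then obtain q where q: "q \<in> W" "\<And>w. w \<in> W \<Longrightarrow> inner (z - q) w = 0"
    using orthogonal_decomposition[OF _ \<open>subspace W\<close>] by blast
  have "b (z - q) = 0" if b: "b \<in> B" for b
  proof -
    have bb: "b \<in> bounded_ops" using B b by (rule cstar_algebraD)
    have "adj b (b (z - q)) \<in> W" using range cstar_algebraD(5)[OF B b] by blast
    then have "inner (b (z - q)) (b (z - q)) = 0"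
      using q(2) by (simp flip: inner_adj_right[OF bb])
    then show ?thesis by simp
  qed
  then have "p (z - q) = 0" by (simp add: ker common_kernel_def)
  then have "inner z (z - q) = 0"
    using projectionD(2)[OF p, of z "z - q"] z by simp
  then have "inner (z - q) (z - q) = 0"
    using q by (simp add: inner_diff_left inner_commute)
  then have "z \<in> W" using q(1) by simp
  with e show ?thesis by (simp add: W_def)
qed

text \<open>
  As \<open>1 - p\<close> maps into the common kernel, \<open>b(1 - p) = 0\<close>; the other equation is its adjoint.
\<close>

lemma below_support:
  assumes B: "cstar_algebra B" and p: "projection p" and ker: "\<And>w. p w = 0 \<longleftrightarrow> w \<in> common_kernel B"
    and b: "b \<in> B"
  shows "p o\<^sub>L b = b" "b o\<^sub>L p = b"
proof -
  have right: "b o\<^sub>L p = b" if b: "b \<in> B" for b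
  proof (rule blinfun_eqI)
    fix w
    have "w - p w \<in> common_kernel B"
      using ker[of "w - p w"] projectionD(3)[OF p] by (simp add: blinfun.diff_right)
    then show "(b o\<^sub>L p) w = b w"
      using b by (simp add: common_kernel_def blinfun.diff_right)
  qed
  show "b o\<^sub>L p = b" using b by (rule right)
  have bb: "b \<in> bounded_ops" using B b by (rule cstar_algebraD)
  have "adj (adj b o\<^sub>L p) = adj (adj b)"
    using right[OF cstar_algebraD(5)[OF B b]] by simp
  then show "p o\<^sub>L b = b"
    using bb p by (simp add: adj_compose adj_adj adj_in_bounded_ops projectionD)
qed

text \<open>
  Any set between the approximate unit and the positive unit ball has the same supremum. One end of
  this range identifies \<open>support_proj B\<close>, the other shows that it is open.

  An element \<open>b\<close> of the ball satisfies \<open>b = pbp \<le> p\<close>. An upper bound \<open>U\<close> dominates \<open>x = pxp\<close> for all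
  \<open>x\<close> in the approximate unit, and their forms at \<open>w\<close> come arbitrarily close to that of \<open>p\<close>.
\<close>

lemma support_is_sup:
  assumes B: "cstar_algebra B" and p: "projection p" and ker: "\<And>w. p w = 0 \<longleftrightarrow> w \<in> common_kernel B"
    and D: "approx_unit B \<subseteq> D" "D \<subseteq> pos_unit_ball B"
  shows "is_op_sup D p"
  unfolding is_op_sup_def
proof (intro conjI ballI allI impI)
  show sap: "self_adjoint p" using p by (rule projectionD)
next
  fix b assume "b \<in> D"
  then have b: "b \<in> B" "self_adjoint b" "norm b \<le> 1"
    using D(2) by (auto simp: pos_unit_ball_def positive_op_iff)
  have "inner (b w) w \<le> inner (p w) w" for w
  proof -
    have "b w = p (b (p w))"
      using below_support[OF B p ker b(1)] by (metis blinfun_apply_blinfun_compose)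
    then have "inner (b w) w = inner (b (p w)) (p w)" by (simp add: projectionD(2)[OF p])
    also have "\<dots> \<le> norm (b (p w)) * norm (p w)" by (rule norm_cauchy_schwarz)
    also have "\<dots> \<le> (norm b * norm (p w)) * norm (p w)" by (intro mult_right_mono norm_blinfun) auto
    also have "\<dots> \<le> (1 * norm (p w)) * norm (p w)" using b(3) by (intro mult_right_mono) auto
    also have "\<dots> = inner (p w) w"
      using projectionD(2)[OF p, of "p w" w] projectionD(3)[OF p]
      by (simp flip: power2_eq_square add: power2_norm_eq_inner)
    finally show ?thesis .
  qed
  then show "b \<preceq> p" using b(2) projectionD(6)[OF p] by (simp add: op_le_iff)
next
  fix U assume U: "self_adjoint U \<and> (\<forall>S\<in>D. S \<preceq> U)"
  have "inner (p w) w \<le> inner (U w) w" for w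
  proof (rule field_le_epsilon)
    fix e :: real assume "0 < e"
    then obtain x where x: "x \<in> approx_unit B" "inner (p w - x (p w)) (p w) < e"
      using approx_unit_approximates_support[OF B p ker projectionD(3)[OF p]] by blast
    then have xB: "x \<in> B" by (simp add: approx_unit_def)
    have "inner (p w) (p w) = inner (p w) w"
      using projectionD(2,3)[OF p] by metis
    moreover have "inner (x (p w)) (p w) = inner (x w) w"
      using below_support[OF B p ker xB] projectionD(2)[OF p] by (metis blinfun_apply_blinfun_compose)
    moreover have "inner (x w) w \<le> inner (U w) w"
      using U x(1) D(1) by (auto simp: op_le_def positive_op_iff blinfun.diff_left inner_diff)
    ultimately show "inner (p w) w \<le> inner (U w) w + e"
      using x(2) by (simp add: inner_diff_left)
  qed
  then show "p \<preceq> U" using U projectionD(6)[OF p] by (simp add: op_le_iff)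
qed

lemma approx_unit_subset: "cstar_algebra B \<Longrightarrow> approx_unit B \<subseteq> pos_unit_ball B"
  using approx_unit_properties(1) by blast

text \<open>
  From here on, \<open>p\<^sub>B\<close> is used only through its kernel.
\<close>

lemma support_proj_kernel:
  assumes B: "cstar_algebra B"
  shows "projection (support_proj B)" "support_proj B w = 0 \<longleftrightarrow> w \<in> common_kernel B"
proof -
  obtain p where p: "projection p" "\<And>w. p w = 0 \<longleftrightarrow> w \<in> common_kernel B"
    using support_projection_exists[of B] cstar_algebraD(1)[OF B] by blast
  have "support_proj B = p"
    unfolding support_proj_def
    by (rule op_sup_eqI support_is_sup[OF B p] approx_unit_subset[OF B] order_refl)+
  with p show "projection (support_proj B)" "support_proj B w = 0 \<longleftrightarrow> w \<in> common_kernel B"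
    by auto
qed

lemma open_proj_support_proj:
  assumes B: "cstar_algebra B" and "B \<subseteq> A"
  shows "open_proj A (support_proj B)"
proof -
  have "0 \<in> approx_unit B"
    using cstar_algebraD(2)[OF B]
    by (auto simp: approx_unit_def positive_op_iff self_adjoint_iff bounded_ops_intros)
  moreover have "approx_unit B \<subseteq> pos_unit_ball A"
    using approx_unit_subset[OF B] \<open>B \<subseteq> A\<close> by (auto simp: pos_unit_ball_def)
  moreover have "is_op_sup (approx_unit B) (support_proj B)"
    using support_proj_kernel[OF B] approx_unit_subset[OF B] by (intro support_is_sup[OF B]) auto
  ultimately show ?thesis
    unfolding open_proj_def
    using support_proj_kernel(1)[OF B] approx_unit_directed[OF B]
    by (intro conjI exI[of _ "approx_unit B"]) auto
qed

lemma support_compose_eq_0: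
  assumes B: "cstar_algebra B"
  shows "support_proj B o\<^sub>L a = 0 \<longleftrightarrow> (\<forall>b\<in>B. b o\<^sub>L a = 0)"
proof -
  have "(T o\<^sub>L a = 0) = (\<forall>x. T (a x) = 0)" for T :: "'a \<Rightarrow>\<^sub>L 'a"
    by (metis blinfun_apply_blinfun_compose blinfun.zero_left blinfun_eqI)
  then show ?thesis
    by (auto simp: support_proj_kernel[OF B] common_kernel_def)
qed

lemma annihilator_support_proj:
  assumes "cstar_algebra B"
  shows "annihilator A {support_proj B} = annihilator A B"
  by (auto simp: annihilator_def perp_def support_compose_eq_0[OF assms])

lemma blinfun_compose_assoc: "(S o\<^sub>L T) o\<^sub>L U = S o\<^sub>L (T o\<^sub>L U)"
  by (rule blinfun_eqI) simp

lemma complement_compose_eq_0: "(id_blinfun - p) o\<^sub>L a = 0 \<longleftrightarrow> p o\<^sub>L a = a"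
proof -
  have "(id_blinfun - p) o\<^sub>L a = a - (p o\<^sub>L a)"
    by (rule blinfun_eqI) (simp add: blinfun.diff_left)
  then show ?thesis by auto
qed

text \<open>
  Being fixed by \<open>p\<close> from the left and from the right means that \<open>1 - p\<close> kills both \<open>a\<close> and \<open>a*\<close>.
  In this form corners and annihilators can be treated alike, although \<open>1 - p\<close> lies outside \<open>A\<close> in
  general.
\<close>

lemma corner_eq_annihilator:
  assumes A: "cstar_algebra A" and p: "projection p"
  shows "corner A p = annihilator A {id_blinfun - p}"
proof -
  have mem: "a \<in> corner A p \<longleftrightarrow> a \<in> A \<and> p o\<^sub>L a = a \<and> a o\<^sub>L p = a" for a
    unfolding corner_def using projectionD(5)[OF p]
    by (auto simp: blinfun_compose_assoc) (metis blinfun_compose_assoc)+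
  have "p o\<^sub>L adj a = adj a \<longleftrightarrow> a o\<^sub>L p = a" if "a \<in> A" for a
  proof -
    have "a \<in> bounded_ops" using A that by (rule cstar_algebraD)
    then show ?thesis
      by (metis adj_adj adj_compose adj_in_bounded_ops projectionD(1,4)[OF p])
  qed
  then show ?thesis
    by (simp add: set_eq_iff mem annihilator_def perp_def complement_compose_eq_0 cong: conj_cong)
qed

lemma projection_complement: "projection p \<Longrightarrow> projection (id_blinfun - p)"
  by (simp add: projection_iff self_adjoint_iff bounded_ops_intros blinfun.bilinear_simps inner_diff)

lemma corner_complement:
  assumes "cstar_algebra A" "projection p"
  shows "corner A (id_blinfun - p) = annihilator A {p}"
  using corner_eq_annihilator[OF assms(1) projection_complement[OF assms(2)]] by simp

text \<open>
  The set \<open>S\<close> may be any set of bounded operators, so that corners are covered. Rewriting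
  \<open>sa* = 0\<close> as \<open>as* = 0\<close> makes both conditions closed and linear in \<open>a\<close>.
\<close>

lemma cstar_algebra_annihilator:
  assumes A: "cstar_algebra A" and S: "S \<subseteq> bounded_ops"
  shows "cstar_algebra (annihilator A S)"
proof -
  have bb: "a \<in> bounded_ops" if "a \<in> A" for a using A that by (rule cstar_algebraD)
  have mem: "a \<in> annihilator A S \<longleftrightarrow> a \<in> A \<and> (\<forall>s\<in>S. s o\<^sub>L a = 0 \<and> a o\<^sub>L adj s = 0)" for a
  proof -
    have "s o\<^sub>L adj a = 0 \<longleftrightarrow> a o\<^sub>L adj s = 0" if "a \<in> A" "s \<in> S" for s
      using compose_eq_0_adj[of s "adj a"] that S bb by (auto simp: adj_adj adj_in_bounded_ops)
    then show ?thesis by (auto simp: annihilator_def perp_def)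
  qed
  have "annihilator A S = A \<inter> (\<Inter>s\<in>S. {a. s o\<^sub>L a = 0} \<inter> {a. a o\<^sub>L adj s = 0})"
    using mem by blast
  moreover have "closed \<dots>"
    using cstar_algebraD(6)[OF A]
    by (intro closed_Int closed_INT ballI closed_Collect_eq continuous_intros) auto
  ultimately have "closed (annihilator A S)" by simp
  moreover have "scaleC_op c a \<in> annihilator A S" if "a \<in> annihilator A S" for c a
  proof -
    have "scaleC_op c a o\<^sub>L T = scaleC_op c (a o\<^sub>L T)" for T
      by (rule blinfun_eqI) (simp add: scaleC_op.rep_eq)
    moreover have "s o\<^sub>L scaleC_op c a = scaleC_op c (s o\<^sub>L a)" if "s \<in> S" for s
      using S that by (intro blinfun_eqI) (auto simp: scaleC_op.rep_eq bounded_opsD)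
    moreover have "scaleC_op c 0 = 0"
      by (rule blinfun_eqI) (simp add: scaleC_op.rep_eq)
    ultimately show ?thesis using that A unfolding mem cstar_algebra_def by metis
  qed
  moreover have "adj a \<in> annihilator A S" if "a \<in> annihilator A S" for a
    using that A by (auto simp: annihilator_def perp_def adj_adj bb cstar_algebraD)
  moreover have "a + b \<in> annihilator A S" "a o\<^sub>L b \<in> annihilator A S"
    if "a \<in> annihilator A S" "b \<in> annihilator A S" for a b
    using that A by (auto simp: mem cstar_algebraD bounded_bilinear.add_left[OF bounded_bilinear_blinfun_compose]
       bounded_bilinear.add_right[OF bounded_bilinear_blinfun_compose])
       (metis blinfun_compose_assoc blinfun_compose_zero(1), metis blinfun_compose_assoc blinfun_compose_zero(2))
  ultimately show ?thesis
    using A by (auto simp: cstar_algebra_def mem)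
qed

section \<open>Annihilators and regular open projections\<close>

text \<open>
  The relation \<open>perp\<close> is not symmetric, so this is not the usual argument for a Galois connection: \<open>S\<close>
  need not lie in its second annihilator. But \<open>s*s\<close> does lie in the annihilator of \<open>S\<^sup>\<bottom>\<close> for \<open>s \<in> S\<close>,
  and \<open>s*sa = 0\<close> already gives \<open>sa = 0\<close>. The other inclusion uses that annihilators are closed
  under adjoints.
\<close>

lemma annihilator_annihilator:
  assumes A: "cstar_algebra A" and S: "S \<subseteq> A"
  shows "annihilator A (annihilator A (annihilator A S)) = annihilator A S"
proof
  have bb: "a \<in> bounded_ops" "adj a \<in> A" "adj (adj a) = a" if "a \<in> A" for a
    using cstar_algebraD[OF A] that by (auto intro: adj_adj)
  show "annihilator A (annihilator A (annihilator A S)) \<subseteq> annihilator A S"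
  proof
    fix a assume a: "a \<in> annihilator A (annihilator A (annihilator A S))"
    then have aA: "a \<in> A" by (simp add: annihilator_def)
    have "s o\<^sub>L a = 0 \<and> s o\<^sub>L adj a = 0" if s: "s \<in> S" for s
    proof -
      have sA: "s \<in> A" using s S by blast
      let ?t = "adj s o\<^sub>L s"
      have tA: "?t \<in> A" using A sA bb by (intro cstar_algebraD)
      have t: "adj ?t = ?t" using bb sA by (simp add: adj_compose adj_in_bounded_ops)
      have "b o\<^sub>L ?t = 0" if "b \<in> annihilator A S" for b
      proof -
        have b: "b \<in> A" "s o\<^sub>L adj b = 0" using that s by (auto simp: annihilator_def perp_def)
        then have "b o\<^sub>L adj s = 0"
          using compose_eq_0_adj[of s "adj b"] bb sA by simp
        then show ?thesis by (simp flip: blinfun_compose_assoc)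
      qed
      with tA t have "?t \<in> annihilator A (annihilator A S)"
        by (auto simp: annihilator_def perp_def)
      with a have *: "?t o\<^sub>L a = 0" "?t o\<^sub>L adj a = 0" by (auto simp: annihilator_def perp_def)
      have "s o\<^sub>L T = 0" if "?t o\<^sub>L T = 0" for T :: "'a \<Rightarrow>\<^sub>L 'a"
      proof (rule blinfun_eqI)
        fix w
        have "adj s (s (T w)) = 0"
          using arg_cong[OF that, of "\<lambda>R. blinfun_apply R w"] by simp
        then have "inner (s (T w)) (s (T w)) = 0"
          using bb(1)[OF sA] by (metis inner_adj_right inner_zero_right)
        then show "(s o\<^sub>L T) w = blinfun_apply 0 w" by simp
      qed
      with * show ?thesis by blast
    qed
    with aA show "a \<in> annihilator A S" by (simp add: annihilator_def perp_def)
  qed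
  show "annihilator A S \<subseteq> annihilator A (annihilator A (annihilator A S))"
  proof
    fix b assume b: "b \<in> annihilator A S"
    then have b': "b \<in> A" "adj b \<in> annihilator A S"
      using bb by (auto simp: annihilator_def perp_def)
    have "t o\<^sub>L b = 0 \<and> t o\<^sub>L adj b = 0" if "t \<in> annihilator A (annihilator A S)" for t
    proof -
      have t: "t \<in> A" "b o\<^sub>L adj t = 0" "adj b o\<^sub>L adj t = 0"
        using that b b' by (auto simp: annihilator_def perp_def)
      then show ?thesis
        using compose_eq_0_adj[of b "adj t"] compose_eq_0_adj[of "adj b" "adj t"] bb b' by simp
    qed
    with b' show "b \<in> annihilator A (annihilator A (annihilator A S))"
      by (simp add: annihilator_def perp_def)
  qed
qed

text \<open>
  An operator \<open>T\<close> that commutes with \<open>A\<close> maps the common kernel of \<open>B\<close>, the kernel of \<open>p\<close>, into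
  itself. So does its adjoint, since \<open>A\<close> is closed under adjoints; thus \<open>T\<close> preserves the range
  of \<open>p\<close> as well and commutes with \<open>p\<close>.
\<close>

lemma support_proj_in_double_commutant:
  assumes A: "cstar_algebra A" and B: "cstar_algebra B" "B \<subseteq> A"
  shows "support_proj B \<in> commutant (commutant A)"
proof -
  define p where "p = support_proj B"
  have p: "projection p" and ker: "\<And>w. p w = 0 \<longleftrightarrow> w \<in> common_kernel B"
    using support_proj_kernel[OF B(1)] by (simp_all add: p_def)
  have invariant: "p (T (w - p w)) = 0" if T: "T \<in> commutant A" for T w
  proof -
    have "p (w - p w) = 0" using projectionD(3)[OF p] by (simp add: blinfun.diff_right)
    then have "b (w - p w) = 0" if "b \<in> B" for b
      using that ker by (simp add: common_kernel_def)
    moreover have "b (T v) = T (b v)" if "b \<in> B" for b v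
      using that T B(2) by (auto simp: commutant_def simp flip: blinfun_apply_blinfun_compose)
    ultimately have "T (w - p w) \<in> common_kernel B"
      by (simp add: common_kernel_def)
    then show ?thesis by (simp add: ker)
  qed
  have "p o\<^sub>L T = T o\<^sub>L p" if T: "T \<in> commutant A" for T
  proof -
    have Tb: "T \<in> bounded_ops" and TA: "\<And>a. a \<in> A \<Longrightarrow> T o\<^sub>L a = a o\<^sub>L T"
      using T by (auto simp: commutant_def)
    have "adj T o\<^sub>L a = a o\<^sub>L adj T" if "a \<in> A" for a
    proof -
      have "adj (T o\<^sub>L adj a) = adj (adj a o\<^sub>L T)"
        using TA[of "adj a"] cstar_algebraD(5)[OF A that] by simp
      then show ?thesis
        using Tb cstar_algebraD(1)[OF A that] by (simp add: adj_compose adj_in_bounded_ops adj_adj)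
    qed
    then have T': "adj T \<in> commutant A" by (simp add: commutant_def Tb adj_in_bounded_ops)
    have 1: "p (T w) = p (T (p w))" for w
      using invariant[OF T, of w] by (simp add: blinfun.diff_right)
    have 2: "p (adj T w) = p (adj T (p w))" for w
      using invariant[OF T', of w] by (simp add: blinfun.diff_right)
    have "inner (T (p x)) y = inner (p (T (p x))) y" for x y
    proof -
      have "inner (T (p x)) y = inner x (p (adj T y))"
        using projectionD(2)[OF p, of x "adj T y"] inner_adj_right[OF Tb, of "p x" y] by simp
      also have "\<dots> = inner x (p (adj T (p y)))" using 2[of y] by (rule arg_cong)
      also have "\<dots> = inner (T (p x)) (p y)"
        using projectionD(2)[OF p, of x "adj T (p y)"] inner_adj_right[OF Tb, of "p x" "p y"] by simp
      finally show ?thesis using projectionD(2)[OF p, of "T (p x)" y] by simp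
    qed
    then have "T o\<^sub>L p = p o\<^sub>L (T o\<^sub>L p)" by (intro blinfun_ext_inner) simp
    moreover have "p o\<^sub>L T = p o\<^sub>L (T o\<^sub>L p)" by (intro blinfun_eqI) (simp flip: 1)
    ultimately show ?thesis by simp
  qed
  then show ?thesis
    using projectionD(1)[OF p] by (simp add: commutant_def p_def)
qed

text \<open>
  The corner could exceed \<open>B = S\<^sup>\<bottom>\<close> for a general subalgebra. Here each \<open>s \<in> S\<close> satisfies \<open>sp = 0\<close>,
  because \<open>B\<close> kills the range of \<open>s*\<close>; and \<open>sp = 0\<close> passes to every \<open>a = pa\<close>.
\<close>

lemma corner_support_proj_annihilator:
  assumes A: "cstar_algebra A" and S: "S \<subseteq> A"
  shows "corner A (support_proj (annihilator A S)) = annihilator A S"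
proof -
  define B where "B = annihilator A S"
  have bb: "a \<in> bounded_ops" "adj a \<in> A" "adj (adj a) = a" if "a \<in> A" for a
    using cstar_algebraD[OF A] that by (auto intro: adj_adj)
  have B: "cstar_algebra B"
    unfolding B_def using A S bb by (intro cstar_algebra_annihilator) auto
  define p where "p = support_proj B"
  have p: "projection p" unfolding p_def by (rule support_proj_kernel[OF B])
  have ker: "\<And>w. p w = 0 \<longleftrightarrow> w \<in> common_kernel B"
    unfolding p_def by (rule support_proj_kernel[OF B])
  have "corner A p = B"
    unfolding corner_eq_annihilator[OF A p]
  proof
    show "B \<subseteq> annihilator A {id_blinfun - p}"
      using below_support[OF B p ker] cstar_algebraD(5)[OF B]
      by (auto simp: annihilator_def perp_def complement_compose_eq_0) (simp add: B_def annihilator_def)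
    have sp: "s o\<^sub>L p = 0" if s: "s \<in> S" for s
    proof -
      have "b o\<^sub>L adj s = 0" if "b \<in> B" for b
        using that s S compose_eq_0_adj[of s "adj b"] bb
        by (auto simp: B_def annihilator_def perp_def)
      then have "p o\<^sub>L adj s = 0"
        unfolding p_def support_compose_eq_0[OF B] by blast
      then show ?thesis
        using compose_eq_0_adj[of s p] projectionD(1,4)[OF p] bb s S by auto
    qed
    show "annihilator A {id_blinfun - p} \<subseteq> B"
      using sp by (auto simp: annihilator_def perp_def B_def complement_compose_eq_0)
        (metis blinfun_compose_assoc blinfun_compose_zero(1))+
  qed
  then show ?thesis by (simp add: p_def B_def)
qed

lemma support_proj_mono_iff:
  assumes A: "cstar_algebra A" and "S \<subseteq> A" "S' \<subseteq> A"
  shows "proj_le (support_proj (annihilator A S)) (support_proj (annihilator A S'))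
    \<longleftrightarrow> annihilator A S \<subseteq> annihilator A S'"
proof -
  define B C where "B = annihilator A S" and "C = annihilator A S'"
  have bb: "a \<in> bounded_ops" if "a \<in> A" for a
    using A that by (rule cstar_algebraD)
  have BC: "cstar_algebra B" "cstar_algebra C"
    unfolding B_def C_def using assms bb by (auto intro!: cstar_algebra_annihilator)
  define p q where "p = support_proj B" and "q = support_proj C"
  have p: "projection p" and kerp: "\<And>w. p w = 0 \<longleftrightarrow> w \<in> common_kernel B"
    using support_proj_kernel[OF BC(1)] by (simp_all add: p_def)
  have q: "projection q" and kerq: "\<And>w. q w = 0 \<longleftrightarrow> w \<in> common_kernel C"
    using support_proj_kernel[OF BC(2)] by (simp_all add: q_def)
  have "proj_le p q \<longleftrightarrow> B \<subseteq> C"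
  proof
    assume "proj_le p q"
    then have "adj (p o\<^sub>L q) = adj p" by (simp add: proj_le_def)
    then have qp: "q o\<^sub>L p = p"
      using p q by (simp add: adj_compose projectionD)
    have abs: "q o\<^sub>L a = a" if "p o\<^sub>L a = a" for a :: "'a \<Rightarrow>\<^sub>L 'a"
      using qp that by (metis blinfun_compose_assoc)
    have "corner A p \<subseteq> corner A q"
      unfolding corner_eq_annihilator[OF A p] corner_eq_annihilator[OF A q]
      using abs by (auto simp: annihilator_def perp_def complement_compose_eq_0)
    then show "B \<subseteq> C"
      using corner_support_proj_annihilator[OF A] assms by (simp add: p_def q_def B_def C_def)
  next
    assume "B \<subseteq> C"
    have "p w = p (q w)" for w
    proof -
      have "q (w - q w) = 0" using projectionD(3)[OF q] by (simp add: blinfun.diff_right)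
      then have "p (w - q w) = 0"
        using \<open>B \<subseteq> C\<close> unfolding kerp kerq by (auto simp: common_kernel_def)
      then show ?thesis by (simp add: blinfun.diff_right)
    qed
    then show "proj_le p q"
      unfolding proj_le_def by (intro blinfun_eqI) simp
  qed
  then show ?thesis by (simp add: p_def q_def B_def C_def)
qed

text \<open>
  Each of the two complements involved turns a corner into an annihilator.
\<close>

lemma proj_interior_closure:
  assumes A: "cstar_algebra A" and p: "projection p"
  shows "proj_interior A (proj_closure A p) = support_proj (annihilator A (annihilator A {p}))"
proof -
  let ?C = "annihilator A {p}"
  have C: "cstar_algebra ?C"
    using p by (intro cstar_algebra_annihilator A) (auto intro: projectionD)
  have "proj_closure A p = id_blinfun - support_proj ?C"
    by (simp add: proj_closure_def proj_interior_def corner_complement[OF A p] support_proj_def)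
  then show ?thesis
    by (simp add: proj_interior_def corner_complement[OF A] support_proj_kernel(1)[OF C]
        annihilator_support_proj[OF C] flip: support_proj_def)
qed

theorem theorem3p4:
  fixes A :: "('h::complex_hilbert \<Rightarrow>\<^sub>L 'h) set"
  assumes "cstar_algebra A" and "nondegenerate A"
  shows "order_iso_on (annihilators A) (\<subseteq>) (regular_open_projs A) proj_le support_proj
    \<and> order_iso_on (regular_open_projs A) proj_le (annihilators A) (\<subseteq>) (corner A)
    \<and> (\<forall>B\<in>annihilators A. corner A (support_proj B) = B)
    \<and> (\<forall>p\<in>regular_open_projs A. support_proj (corner A p) = p)"
proof -
  note A = \<open>cstar_algebra A\<close>
  have cstar: "cstar_algebra B" "B \<subseteq> A" if "B \<in> annihilators A" for B
  proof -
    from that obtain S where S: "S \<subseteq> A" "B = annihilator A S" by (auto simp: annihilators_def)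
    moreover have "S \<subseteq> bounded_ops" using S(1) cstar_algebraD(1)[OF A] by blast
    ultimately show "cstar_algebra B" by (simp add: cstar_algebra_annihilator[OF A])
    show "B \<subseteq> A" using S(2) by (auto simp: annihilator_def)
  qed
  have corner_support: "corner A (support_proj B) = B" if "B \<in> annihilators A" for B
    using that corner_support_proj_annihilator[OF A] unfolding annihilators_def by blast
  have regular: "support_proj B \<in> regular_open_projs A" if B: "B \<in> annihilators A" for B
  proof -
    have "annihilator A (annihilator A B) = B"
      using B annihilator_annihilator[OF A] by (auto simp: annihilators_def)
    then have "proj_interior A (proj_closure A (support_proj B)) = support_proj B"
      using support_proj_kernel(1)[OF cstar(1)[OF B]]
      by (simp add: proj_interior_closure[OF A] annihilator_support_proj[OF cstar(1)[OF B]])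
    then show ?thesis
      using support_proj_kernel(1) support_proj_in_double_commutant[OF A] open_proj_support_proj cstar[OF B]
      unfolding regular_open_projs_def by blast
  qed
  have obtain_annihilator: "\<exists>B\<in>annihilators A. support_proj B = p" if "p \<in> regular_open_projs A" for p
  proof -
    have p: "projection p" "proj_interior A (proj_closure A p) = p"
      using that by (simp_all add: regular_open_projs_def)
    then have "support_proj (annihilator A (annihilator A {p})) = p"
      using proj_interior_closure[OF A p(1)] by simp
    moreover have "annihilator A (annihilator A {p}) \<in> annihilators A"
    proof -
      have "annihilator A {p} \<subseteq> A" by (auto simp: annihilator_def)
      then show ?thesis unfolding annihilators_def by blast
    qed
    ultimately show ?thesis by blast
  qed
  have support_corner: "support_proj (corner A p) = p" and corner: "corner A p \<in> annihilators A"
    if "p \<in> regular_open_projs A" for p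
    using obtain_annihilator[OF that] corner_support by auto
  have mono: "B \<subseteq> C \<longleftrightarrow> proj_le (support_proj B) (support_proj C)"
    if "B \<in> annihilators A" "C \<in> annihilators A" for B C
    using that support_proj_mono_iff[OF A] unfolding annihilators_def by blast
  have bij: "bij_betw support_proj (annihilators A) (regular_open_projs A)"
    using corner_support regular support_corner corner
    by (intro bij_betw_byWitness[where f' = "corner A"]) auto
  have bij': "bij_betw (corner A) (regular_open_projs A) (annihilators A)"
    using corner_support regular support_corner corner
    by (intro bij_betw_byWitness[where f' = support_proj]) auto
  have mono': "proj_le p q \<longleftrightarrow> corner A p \<subseteq> corner A q"
    if "p \<in> regular_open_projs A" "q \<in> regular_open_projs A" for p q
    using mono[OF corner corner] support_corner that by simp
  show ?thesis
    unfolding order_iso_on_def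
    by (intro conjI ballI bij bij' mono mono' corner_support support_corner)
qed

end
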